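(* For every choice of shared class constants $\beta\ge 0$, $0<c_-\le c_+<\infty$, $\bar s_0>0$, $s_R\in(0,\bar s_0]$, the shape index $\alpha$ is identifiable over $\mathcal{M}_\star$: if $(F_S,K),(F'_S,K')\in\mathcal{M}_\star$, with A1 shape indices $\alpha$ and $\alpha'$ respectively, satisfy $KF_S=K'F'_S$ (as Borel probability laws on $[0,\infty]$), then $\alpha=\alpha'$.
   Context: A pair $(F_S,K)$ consists of a Borel probability law $F_S$ on $[0,\infty)$ and a Markov kernel $K$ from $[0,\infty)$ to the compactified half-line $[0,\infty]$ such that $K([0,\infty)\mid s)>0$ for every $s\ge 0$ (well-posedness). Its observed law is the Borel probability $KF_S$ on $[0,\infty]$, $(KF_S)(B)=\int_{[0,\infty)}K(B\mid s)\,F_S(ds)$. The lower conditional edge is $\ell(s):=\inf(\operatorname{supp}K(\cdot\mid s)\cap[0,\infty))$, with $\operatorname{supp}$ the topological support in $[0,\infty]$. Shared class constants: $\beta\ge 0$, $0<c_-\le c_+<\infty$, $\bar s_0>0$, $s_R\in(0,\bar s_0]$ (common to all members). Axioms: A1: $F_S(\{0\})=0$ and there are $s_0\ge\bar s_0$, $L\in(0,\infty)$, $\alpha\in[0,\infty)$ (member-specific; $\alpha$ is the shape index) such that $F_S$ has a density $f_S$ on $(0,s_0)$ (a fixed version) with $f_S(s)=L s^{\alpha}(1+o(1))$ pointwise as $s\downarrow 0$. A5$^-$: the limit $a:=\ell(0+)\in[0,\infty)$ exists; $c_-s\le\ell(s)-a\le c_+s$ for all $s\in(0,s_R]$; and $\ell$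 is nondecreasing on $[0,\infty)$, where by notational convention $\ell(0):=a$ (no constraint on $K(\cdot\mid 0)$). A6: there is a map $c_K:(0,s_R]\to(0,\infty)$ with $0<\liminf_{s\downarrow 0}c_K(s)\le\limsup_{s\downarrow 0}c_K(s)<\infty$ such that for every $\varepsilon>0$ there is $\eta(\varepsilon)>0$ with $(1-\varepsilon)c_K(s)\delta^{\beta+1}\le K([\ell(s),\ell(s)+\delta]\mid s)\le(1+\varepsilon)c_K(s)\delta^{\beta+1}$ for all $s\in(0,s_R]$ and $\delta\in(0,\eta(\varepsilon)]$. The lean class $\mathcal{M}_\star$ is the set of all pairs $(F_S,K)$ satisfying well-posedness, A1, A5$^-$ and A6 with the given shared constants. *)

theory Defs
  imports "HOL-Probability.Probability" "HOL-Library.Landau_Symbols"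
begin

text \<open>
  The half-line $[0,\infty)$ is the measurable space \<open>restrict_space borel {0..}\<close> over the reals;
  the compactified half-line $[0,\infty]$ is the type \<open>ennreal\<close> with its order topology.
  Laws and Markov kernels are elements of, resp. measurable maps into, \<open>prob_algebra\<close>.
\<close>

abbreviation half_line :: "real measure" where
  "half_line \<equiv> restrict_space borel {0..}"

definition law_kernel_pair :: "real measure \<Rightarrow> (real \<Rightarrow> ennreal measure) \<Rightarrow> bool" where
  "law_kernel_pair F K \<longleftrightarrow>
     F \<in> space (prob_algebra half_line) \<and>
     K \<in> half_line \<rightarrow>\<^sub>M prob_algebra borel \<and>
     (\<forall>s\<ge>0. emeasure (K s) {..<\<infinity>} > 0)"

definition observed_law :: "real measure \<Rightarrow> (real \<Rightarrow> ennreal measure) \<Rightarrow> ennreal measure" where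
  "observed_law F K = F \<bind> K"

lemma emeasure_observed_law:
  assumes "law_kernel_pair F K" "B \<in> sets borel"
  shows "emeasure (observed_law F K) B = (\<integral>\<^sup>+ s. emeasure (K s) B \<partial>F)"
  using assms unfolding law_kernel_pair_def observed_law_def
  by (blast intro: emeasure_bind_prob_algebra)

definition topological_support :: "'a::topological_space measure \<Rightarrow> 'a set" where
  "topological_support M = {x. \<forall>U. open U \<longrightarrow> x \<in> U \<longrightarrow> emeasure M U > 0}"

text \<open>
  The set below is nonempty whenever $K([0,\infty) \mid s) > 0$, by second countability, so the
  infimum is then finite and \<open>enn2real\<close> loses nothing.
\<close>

definition lower_edge :: "(real \<Rightarrow> ennreal measure) \<Rightarrow> real \<Rightarrow> real" where
  "lower_edge K s = enn2real (Inf (topological_support (K s) \<inter> {..<\<infinity>}))"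

lemma topological_support_finite_part_nonempty:
  assumes K: "law_kernel_pair F K" and s: "s \<ge> 0"
  shows "topological_support (K s) \<inter> {..<\<infinity>} \<noteq> {}"
proof
  assume empty: "topological_support (K s) \<inter> {..<\<infinity>} = {}"
  have "K s \<in> space (prob_algebra borel)"
    using K s by (auto simp: law_kernel_pair_def dest!: measurable_space[where x = s])
  then have sets: "sets (K s) = sets borel"
    by (simp add: space_prob_algebra)
  obtain \<B> :: "ennreal set set" where \<B>: "countable \<B>" "topological_basis \<B>"
    using ex_countable_basis by blast
  define \<N> where "\<N> = {B \<in> \<B>. emeasure (K s) B = 0}"
  have "\<exists>B\<in>\<N>. x \<in> B" if "x \<in> {..<\<infinity>}" for x
  proof -
    from empty that have "x \<notin> topological_support (K s)" by auto
    then obtain U where U: "open U" "x \<in> U" "emeasure (K s) U = 0"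
      by (auto simp: topological_support_def not_gr_zero)
    obtain B where B: "B \<in> \<B>" "x \<in> B" "B \<subseteq> U"
      using topological_basisE[OF \<B>(2) U(1,2)] by blast
    have "emeasure (K s) B \<le> emeasure (K s) U"
      using U B by (intro emeasure_mono) (auto simp: sets)
    then show ?thesis using U B by (auto simp: \<N>_def)
  qed
  then have "{..<\<infinity>} \<subseteq> \<Union>\<N>" by auto
  moreover have "\<Union>\<N> \<in> null_sets (K s)"
  proof -
    have "\<N> \<subseteq> null_sets (K s)"
      using \<B>(2) by (auto simp: \<N>_def null_sets_def sets intro!: borel_open topological_basis_open)
    moreover have "countable \<N>" using \<B>(1) by (auto simp: \<N>_def)
    ultimately have "(\<Union>N\<in>\<N>. N) \<in> null_sets (K s)" by (intro null_sets_UN') auto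
    then show ?thesis by simp
  qed
  ultimately have "emeasure (K s) {..<\<infinity>} \<le> emeasure (K s) (\<Union>\<N>)"
    by (intro emeasure_mono) auto
  with \<open>\<Union>\<N> \<in> null_sets (K s)\<close> have "emeasure (K s) {..<\<infinity>} = 0" by auto
  with K s show False by (auto simp: law_kernel_pair_def)
qed

definition axiom_A1 :: "real \<Rightarrow> real measure \<Rightarrow> real \<Rightarrow> bool" where
  "axiom_A1 sbar0 F \<alpha> \<longleftrightarrow>
     \<alpha> \<ge> 0 \<and> emeasure F {0} = 0 \<and>
     (\<exists>s0 L f. s0 \<ge> sbar0 \<and> L > 0 \<and>
        f \<in> borel_measurable borel \<and> (\<forall>s\<in>{0<..<s0}. f s \<ge> 0) \<and>
        (\<forall>B\<in>sets borel. B \<subseteq> {0<..<s0} \<longrightarrow>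
           emeasure F B = (\<integral>\<^sup>+ s\<in>B. ennreal (f s) \<partial>lborel)) \<and>
        f \<sim>[at_right 0] (\<lambda>s. L * s powr \<alpha>))"

text \<open>
  The value of the edge at $0$ is by convention its right limit \<open>a\<close>, irrespective of the
  kernel at $0$.
\<close>

definition axiom_A5_minus :: "real \<Rightarrow> real \<Rightarrow> real \<Rightarrow> (real \<Rightarrow> ennreal measure) \<Rightarrow> bool" where
  "axiom_A5_minus c_lo c_hi s_R K \<longleftrightarrow>
     (\<exists>a\<ge>0. (lower_edge K \<longlongrightarrow> a) (at_right 0) \<and>
        (\<forall>s\<in>{0<..s_R}. c_lo * s \<le> lower_edge K s - a \<and> lower_edge K s - a \<le> c_hi * s) \<and>
        mono_on {0..} ((lower_edge K)(0 := a)))"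

definition axiom_A6 :: "real \<Rightarrow> real \<Rightarrow> (real \<Rightarrow> ennreal measure) \<Rightarrow> bool" where
  "axiom_A6 \<beta> s_R K \<longleftrightarrow>
     (\<exists>c. (\<forall>s\<in>{0<..s_R}. c s > 0) \<and>
        0 < Liminf (at_right 0) (\<lambda>s. ereal (c s)) \<and>
        Limsup (at_right 0) (\<lambda>s. ereal (c s)) < \<infinity> \<and>
        (\<forall>\<epsilon>>0. \<exists>\<eta>>0. \<forall>s\<in>{0<..s_R}. \<forall>\<delta>\<in>{0<..\<eta>}.
           (let p = measure (K s) {ennreal (lower_edge K s)..ennreal (lower_edge K s + \<delta>)} in
            (1 - \<epsilon>) * c s * \<delta> powr (\<beta> + 1) \<le> p \<and> p \<le> (1 + \<epsilon>) * c s * \<delta> powr (\<beta> + 1))))"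

definition lean_class ::
  "real \<Rightarrow> real \<Rightarrow> real \<Rightarrow> real \<Rightarrow> real \<Rightarrow> (real measure \<times> (real \<Rightarrow> ennreal measure)) set" where
  "lean_class \<beta> c_lo c_hi sbar0 s_R =
     {(F, K). law_kernel_pair F K \<and> (\<exists>\<alpha>. axiom_A1 sbar0 F \<alpha>) \<and>
        axiom_A5_minus c_lo c_hi s_R K \<and> axiom_A6 \<beta> s_R K}"

end

theory Submission
  imports Defs
begin

text \<open>
  No mass of \<open>K s\<close> lies below the edge \<open>\<ell> s\<close>, and \<open>\<ell> s - a\<close> is comparable to \<open>s\<close>. Hence only sources
  \<open>s \<le> t / c_lo\<close> can be observed in \<open>[0, a + t]\<close>, each with probability of order at most
  \<open>t powr (\<beta> + 1)\<close>, and sources \<open>s \<le> t / (2 * c_hi)\<close> are observed there with probability of at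
  least that order. Such sources have \<open>F\<close>-mass of order \<open>t powr (\<alpha> + 1)\<close>, so the observed law of
  \<open>[0, a + t]\<close> is of exact order \<open>t powr (\<alpha> + \<beta> + 2)\<close>. This determines first \<open>a\<close>, as the left end
  of the observed law, and then \<open>\<alpha>\<close>.
\<close>

section \<open>Support, lower edge and null sets\<close>

text \<open>Each point of \<open>U\<close> has a null open neighbourhood, which may be shrunk to a
  basic open set. Second countability leaves only countably many such sets, so their union is null
  and covers \<open>U\<close>.\<close>

lemma emeasure_eq_0_if_disjoint_topological_support:
  fixes M :: "'a::second_countable_topology measure"
  assumes sets: "sets M = sets borel" and U: "open U" "U \<inter> topological_support M = {}"
  shows "emeasure M U = 0"
proof -
  obtain \<B> :: "'a set set" where \<B>: "countable \<B>" "topological_basis \<B>"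
    using ex_countable_basis by blast
  define \<N> where "\<N> = {B \<in> \<B>. emeasure M B = 0}"
  have "\<exists>B\<in>\<N>. x \<in> B" if "x \<in> U" for x
  proof -
    from U that have "x \<notin> topological_support M" by auto
    then obtain V where V: "open V" "x \<in> V" "emeasure M V = 0"
      by (auto simp: topological_support_def not_gr_zero)
    obtain B where B: "B \<in> \<B>" "x \<in> B" "B \<subseteq> V"
      using topological_basisE[OF \<B>(2) V(1,2)] by blast
    have "emeasure M B \<le> emeasure M V"
      using V B by (intro emeasure_mono) (auto simp: sets)
    then show ?thesis using V B by (auto simp: \<N>_def)
  qed
  then have "U \<subseteq> \<Union>\<N>" by auto
  moreover have "\<Union>\<N> \<in> null_sets M"
  proof -
    have "\<N> \<subseteq> null_sets M"
      using \<B>(2) by (auto simp: \<N>_def null_sets_def sets intro!: borel_open topological_basis_open)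
    moreover have "countable \<N>" using \<B>(1) by (auto simp: \<N>_def)
    ultimately have "(\<Union>N\<in>\<N>. N) \<in> null_sets M" by (intro null_sets_UN') auto
    then show ?thesis by simp
  qed
  ultimately show ?thesis
    using emeasure_mono[of U "\<Union>\<N>" M] by (auto simp: null_sets_def)
qed

lemma kernel_prob_space:
  assumes "law_kernel_pair F K" "s \<ge> 0"
  shows "prob_space (K s)" "sets (K s) = sets borel"
proof -
  have "K s \<in> space (prob_algebra borel)"
    using assms by (auto simp: law_kernel_pair_def dest!: measurable_space[where x = s])
  then show "prob_space (K s)" "sets (K s) = sets borel"
    by (simp_all add: space_prob_algebra)
qed

text \<open>The infimum defining the edge is finite, so \<open>enn2real\<close> does not change it.
  A support point below the edge would be finite as well and hence could not lie below the infimum.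
  The open ray below the edge thus misses the support.\<close>

lemma emeasure_below_lower_edge:
  assumes K: "law_kernel_pair F K" and s: "s \<ge> 0"
  shows "emeasure (K s) {..<ennreal (lower_edge K s)} = 0"
proof (rule emeasure_eq_0_if_disjoint_topological_support[OF kernel_prob_space(2)[OF K s]])
  let ?S = "topological_support (K s) \<inter> {..<\<infinity>}"
  obtain y where y: "y \<in> ?S"
    using topological_support_finite_part_nonempty[OF K s] by blast
  have "Inf ?S \<le> y" using y by (rule Inf_lower)
  also have "y < top" using y by simp
  finally have "Inf ?S < top" .
  then have eq: "ennreal (lower_edge K s) = Inf ?S" by (simp add: lower_edge_def)
  show "{..<ennreal (lower_edge K s)} \<inter> topological_support (K s) = {}"
  proof (intro equals0I)
    fix x assume "x \<in> {..<ennreal (lower_edge K s)} \<inter> topological_support (K s)"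
    then have x: "x < Inf ?S" "x \<in> topological_support (K s)"
      unfolding eq by auto
    have "x < top" using x(1) \<open>Inf ?S < top\<close> by (rule less_trans)
    with x have "Inf ?S \<le> x" by (intro Inf_lower) auto
    with x show False by simp
  qed
qed simp

text \<open>This turns the observation windows \<open>{..y}\<close> of the observed law into windows
  that start at the edge, the only ones about which A6 speaks.\<close>

lemma emeasure_atMost_eq_atLeastAtMost_lower_edge:
  assumes K: "law_kernel_pair F K" and s: "s \<ge> 0"
  shows "emeasure (K s) {..y} = emeasure (K s) {ennreal (lower_edge K s)..y}"
proof (rule antisym)
  note sets = kernel_prob_space(2)[OF K s]
  have "emeasure (K s) {..y} \<le>
      emeasure (K s) ({..<ennreal (lower_edge K s)} \<union> {ennreal (lower_edge K s)..y})"
    by (rule emeasure_mono) (auto simp: sets)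
  also have "\<dots> \<le> emeasure (K s) {..<ennreal (lower_edge K s)} +
      emeasure (K s) {ennreal (lower_edge K s)..y}"
    by (rule emeasure_subadditive) (auto simp: sets)
  finally show "emeasure (K s) {..y} \<le> emeasure (K s) {ennreal (lower_edge K s)..y}"
    by (simp add: emeasure_below_lower_edge[OF K s])
qed (auto intro!: emeasure_mono simp: kernel_prob_space(2)[OF K s])

section \<open>Two-sided power bounds from A1 and A6\<close>

text \<open>
  For the lower bound the mass of \<open>{r/2..r}\<close> suffices, as the density is comparable to
  \<open>r powr \<alpha>\<close> there.
\<close>

lemma axiom_A1_mass_bounds:
  assumes "axiom_A1 sbar0 F \<alpha>" and "sbar0 > 0" and sets: "sets F = sets half_line"
  obtains C1 C2 r0 :: real where "C1 > 0" "C2 > 0" "r0 > 0"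
    "\<And>r. 0 < r \<Longrightarrow> r \<le> r0 \<Longrightarrow> ennreal (C1 * r powr (\<alpha> + 1)) \<le> emeasure F {0<..r}"
    "\<And>r. 0 < r \<Longrightarrow> r \<le> r0 \<Longrightarrow> emeasure F {0<..r} \<le> ennreal (C2 * r powr (\<alpha> + 1))"
proof -
  obtain s0 L f where s0: "s0 \<ge> sbar0" and L: "L > 0"
    and F: "\<And>B. B \<in> sets borel \<Longrightarrow> B \<subseteq> {0<..<s0} \<Longrightarrow>
           emeasure F B = (\<integral>\<^sup>+ s\<in>B. ennreal (f s) \<partial>lborel)"
    and f: "f \<sim>[at_right 0] (\<lambda>s. L * s powr \<alpha>)" and \<alpha>: "\<alpha> \<ge> 0"
    using assms(1) unfolding axiom_A1_def by blast
  have "eventually (\<lambda>s::real. s > 0) (at_right 0)"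
    by (rule eventually_at_right_less)
  \<comment> \<open>Asymptotic equivalence counts \<open>0 / 0\<close> as \<open>1\<close>; a
    nonzero comparison function near \<open>0\<close> turns it into convergence of the plain
    quotient.\<close>
  with L have "eventually (\<lambda>s. L * s powr \<alpha> \<noteq> 0) (at_right 0)"
    by (auto elim: eventually_mono)
  then have "((\<lambda>s. f s / (L * s powr \<alpha>)) \<longlongrightarrow> 1) (at_right 0)"
    by (rule asymp_equivD_strong[OF f eventually_mono]) auto
  then have "eventually (\<lambda>s. f s / (L * s powr \<alpha>) > 1/2) (at_right 0)"
      "eventually (\<lambda>s. f s / (L * s powr \<alpha>) < 2) (at_right 0)"
    by (auto dest: order_tendstoD(1)[where a = "1/2"] order_tendstoD(2)[where a = 2])
  with \<open>eventually (\<lambda>s::real. s > 0) (at_right 0)\<close>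
  have "eventually (\<lambda>s. L / 2 * s powr \<alpha> \<le> f s \<and> f s \<le> 2 * L * s powr \<alpha>) (at_right 0)"
    by eventually_elim (use L in \<open>auto simp: field_simps\<close>)
  then obtain r1 where r1: "r1 > 0"
    and fb: "\<And>s. 0 < s \<Longrightarrow> s < r1 \<Longrightarrow> L / 2 * s powr \<alpha> \<le> f s \<and> f s \<le> 2 * L * s powr \<alpha>"
    unfolding eventually_at_right_field by blast
  \<comment> \<open>Halving keeps the closed end \<open>r\<close> of \<open>{0<..r}\<close> strictly
    inside both the range of the density and the range of its bounds.\<close>
  define r0 where "r0 = min r1 s0 / 2"
  have r0: "r0 > 0" "r0 < r1" "r0 < s0"
    using r1 s0 assms(2) by (auto simp: r0_def min_def)
  show ?thesis
  proof (rule that[of "L / 4 * (1/2) powr \<alpha>" "2 * L" r0])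
    fix r assume r: "0 < r" "r \<le> r0"
    \<comment> \<open>The constant is the length \<open>r / 2\<close> times
      \<open>L / 2 * (r / 2) powr \<alpha>\<close>. The latter bounds the density below on all of
      \<open>{r/2..r}\<close>, since \<open>\<alpha> \<ge> 0\<close> makes the power smallest at the
      left end.\<close>
    have "ennreal (L / 4 * (1/2) powr \<alpha> * r powr (\<alpha> + 1)) =
        ennreal (L / 2 * (r / 2) powr \<alpha>) * emeasure lborel {r/2..r}"
      using r L by (simp add: ennreal_mult[symmetric] powr_add powr_divide powr_mult field_simps)
    also have "\<dots> = (\<integral>\<^sup>+ s\<in>{r/2..r}. ennreal (L / 2 * (r / 2) powr \<alpha>) \<partial>lborel)"
      by (simp add: nn_integral_cmult_indicator)
    also have "\<dots> \<le> (\<integral>\<^sup>+ s\<in>{r/2..r}. ennreal (f s) \<partial>lborel)"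
    proof (intro nn_integral_mono)
      fix s
      have "L / 2 * (r / 2) powr \<alpha> \<le> f s" if "s \<in> {r/2..r}"
      proof -
        have "L / 2 * (r / 2) powr \<alpha> \<le> L / 2 * s powr \<alpha>"
          using that r L \<alpha> by (intro mult_left_mono powr_mono2) auto
        also have "\<dots> \<le> f s" using that r r0 fb[of s] by auto
        finally show ?thesis .
      qed
      then show "ennreal (L / 2 * (r / 2) powr \<alpha>) * indicator {r/2..r} s
          \<le> ennreal (f s) * indicator {r/2..r} s"
        by (auto simp: indicator_def intro!: ennreal_leI)
    qed
    also have "\<dots> = emeasure F {r/2..r}"
      using r r0 by (intro F[symmetric]) auto
    also have "\<dots> \<le> emeasure F {0<..r}"
      using r by (intro emeasure_mono) (auto simp: sets sets_restrict_space_iff)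
    finally show "ennreal (L / 4 * (1/2) powr \<alpha> * r powr (\<alpha> + 1)) \<le> emeasure F {0<..r}" .
  next
    fix r assume r: "0 < r" "r \<le> r0"
    have "emeasure F {0<..r} = (\<integral>\<^sup>+ s\<in>{0<..r}. ennreal (f s) \<partial>lborel)"
      using r r0 by (intro F) auto
    also have "\<dots> \<le> (\<integral>\<^sup>+ s\<in>{0<..r}. ennreal (2 * L * r powr \<alpha>) \<partial>lborel)"
    proof (intro nn_integral_mono)
      fix s
      have "f s \<le> 2 * L * r powr \<alpha>" if "s \<in> {0<..r}"
      proof -
        have "f s \<le> 2 * L * s powr \<alpha>" using that r r0 fb[of s] by auto
        also have "\<dots> \<le> 2 * L * r powr \<alpha>"
          using that r L \<alpha> by (intro mult_left_mono powr_mono2) auto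
        finally show ?thesis .
      qed
      then show "ennreal (f s) * indicator {0<..r} s
          \<le> ennreal (2 * L * r powr \<alpha>) * indicator {0<..r} s"
        by (auto simp: indicator_def intro!: ennreal_leI)
    qed
    also have "\<dots> = ennreal (2 * L * r powr \<alpha>) * emeasure lborel {0<..r}"
      by (simp add: nn_integral_cmult_indicator)
    also have "\<dots> = ennreal (2 * L * r powr (\<alpha> + 1))"
      using r L by (simp add: ennreal_mult[symmetric] powr_add field_simps)
    finally show "emeasure F {0<..r} \<le> ennreal (2 * L * r powr (\<alpha> + 1))" .
  qed (use L r0 in auto)
qed

text \<open>Near \<open>0\<close> the factor \<open>c s\<close> lies between two positive constants,
  by its lower and upper limits, so a single \<open>\<epsilon> < 1\<close> yields bounds uniform in
  \<open>s\<close>. This uniformity allows integration over the sources.\<close>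

lemma axiom_A6_mass_bounds:
  assumes "axiom_A6 \<beta> s_R K" and K: "law_kernel_pair F K" and "s_R > 0"
  obtains D1 D2 s1 \<eta> :: real where "D1 > 0" "D2 > 0" "0 < s1" "s1 \<le> s_R" "\<eta> > 0"
    "\<And>s \<delta>. 0 < s \<Longrightarrow> s \<le> s1 \<Longrightarrow> 0 < \<delta> \<Longrightarrow> \<delta> \<le> \<eta> \<Longrightarrow>
       ennreal (D1 * \<delta> powr (\<beta> + 1)) \<le>
       emeasure (K s) {ennreal (lower_edge K s)..ennreal (lower_edge K s + \<delta>)}"
    "\<And>s \<delta>. 0 < s \<Longrightarrow> s \<le> s1 \<Longrightarrow> 0 < \<delta> \<Longrightarrow> \<delta> \<le> \<eta> \<Longrightarrow>
       emeasure (K s) {ennreal (lower_edge K s)..ennreal (lower_edge K s + \<delta>)} \<le>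
       ennreal (D2 * \<delta> powr (\<beta> + 1))"
proof -
  obtain c where inf: "0 < Liminf (at_right 0) (\<lambda>s. ereal (c s))"
    and sup: "Limsup (at_right 0) (\<lambda>s. ereal (c s)) < \<infinity>"
    and c: "\<And>\<epsilon>. \<epsilon> > 0 \<Longrightarrow> \<exists>\<eta>>0. \<forall>s\<in>{0<..s_R}. \<forall>\<delta>\<in>{0<..\<eta>}.
           (1 - \<epsilon>) * c s * \<delta> powr (\<beta> + 1) \<le>
             measure (K s) {ennreal (lower_edge K s)..ennreal (lower_edge K s + \<delta>)} \<and>
           measure (K s) {ennreal (lower_edge K s)..ennreal (lower_edge K s + \<delta>)} \<le>
             (1 + \<epsilon>) * c s * \<delta> powr (\<beta> + 1)"
    using assms(1) unfolding axiom_A6_def Let_def by blast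
  obtain m where m: "0 < ereal m" "ereal m < Liminf (at_right 0) (\<lambda>s. ereal (c s))"
    using ereal_dense2[OF inf] by blast
  obtain M where M: "Limsup (at_right 0) (\<lambda>s. ereal (c s)) < ereal M"
    using ereal_dense2[OF sup] by blast
  have "eventually (\<lambda>s. m < c s) (at_right 0)" "eventually (\<lambda>s. c s < M) (at_right 0)"
    using less_LiminfD[OF m(2)] Limsup_lessD[OF M] by simp_all
  then have "eventually (\<lambda>s. m < c s \<and> c s < M) (at_right 0)"
    by (rule eventually_conj)
  then obtain s2 where s2: "s2 > 0" "\<And>s. 0 < s \<Longrightarrow> s < s2 \<Longrightarrow> m < c s \<and> c s < M"
    unfolding eventually_at_right_field by blast
  have mM: "0 < m" "0 < M" using m s2(2)[of "s2/2"] s2(1) by auto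
  obtain \<eta> where \<eta>: "\<eta> > 0" and b: "\<And>s \<delta>. s \<in> {0<..s_R} \<Longrightarrow> \<delta> \<in> {0<..\<eta>} \<Longrightarrow>
           1/2 * c s * \<delta> powr (\<beta> + 1) \<le>
             measure (K s) {ennreal (lower_edge K s)..ennreal (lower_edge K s + \<delta>)} \<and>
           measure (K s) {ennreal (lower_edge K s)..ennreal (lower_edge K s + \<delta>)} \<le>
             3/2 * c s * \<delta> powr (\<beta> + 1)"
    \<comment> \<open>With \<open>\<epsilon> = 1/2\<close> the lower factor
      \<open>1 - \<epsilon>\<close> is still positive.\<close>
    using c[of "1/2"] by auto
  show ?thesis
  proof (rule that[of "1/2 * m" "3/2 * M" "min s_R (s2/2)" \<eta>])
    fix s \<delta> :: real
    assume *: "0 < s" "s \<le> min s_R (s2/2)" "0 < \<delta>" "\<delta> \<le> \<eta>"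
    let ?A = "{ennreal (lower_edge K s)..ennreal (lower_edge K s + \<delta>)}"
    interpret prob_space "K s" using kernel_prob_space[OF K, of s] * by auto
    have cs: "m < c s" "c s < M" using * s2 by auto
    have "1/2 * m * \<delta> powr (\<beta> + 1) \<le> 1/2 * c s * \<delta> powr (\<beta> + 1)"
      using cs by (intro mult_right_mono) auto
    also have "\<dots> \<le> measure (K s) ?A" using b[of s \<delta>] * by auto
    finally have lower: "1/2 * m * \<delta> powr (\<beta> + 1) \<le> measure (K s) ?A" .
    have "measure (K s) ?A \<le> 3/2 * c s * \<delta> powr (\<beta> + 1)" using b[of s \<delta>] * by auto
    also have "\<dots> \<le> 3/2 * M * \<delta> powr (\<beta> + 1)"
      using cs by (intro mult_right_mono) auto
    finally have upper: "measure (K s) ?A \<le> 3/2 * M * \<delta> powr (\<beta> + 1)" .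
    from lower upper
    show "ennreal (1/2 * m * \<delta> powr (\<beta> + 1)) \<le> emeasure (K s) ?A"
      "emeasure (K s) ?A \<le> ennreal (3/2 * M * \<delta> powr (\<beta> + 1))"
      by (auto simp: emeasure_eq_measure intro!: ennreal_leI)
  qed (use mM \<eta> s2 assms(3) in auto)
qed

section \<open>Exact order of the observed law at its left end\<close>

text \<open>The bounds come from integrating the A6 bounds over the sources that reach the window
  and inserting the A1 mass of those sources. The constants may depend on the pair: comparing two
  pairs uses only \<open>a\<close> and the exponent.\<close>

lemma observed_law_edge_asymptotics:
  assumes "(F, K) \<in> lean_class \<beta> c_lo c_hi sbar0 s_R" and A1: "axiom_A1 sbar0 F \<alpha>"
    and c: "0 < c_lo" "c_lo \<le> c_hi" and sb: "0 < sbar0" and sR: "0 < s_R"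
  obtains a C1 C2 t0 :: real where "a \<ge> 0" "C1 > 0" "C2 > 0" "t0 > 0"
    "emeasure (observed_law F K) {..<ennreal a} = 0"
    "\<And>t. 0 < t \<Longrightarrow> t \<le> t0 \<Longrightarrow>
       ennreal (C1 * t powr (\<alpha> + \<beta> + 2)) \<le> emeasure (observed_law F K) {..ennreal (a + t)}"
    "\<And>t. 0 < t \<Longrightarrow> t \<le> t0 \<Longrightarrow>
       emeasure (observed_law F K) {..ennreal (a + t)} \<le> ennreal (C2 * t powr (\<alpha> + \<beta> + 2))"
proof -
  have K: "law_kernel_pair F K" and A5: "axiom_A5_minus c_lo c_hi s_R K"
    and A6: "axiom_A6 \<beta> s_R K"
    using assms(1) by (auto simp: lean_class_def)
  have setsF: "sets F = sets half_line"
    using K by (auto simp: law_kernel_pair_def space_prob_algebra)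
  then have spaceF: "space F = {0..}" by (auto dest: sets_eq_imp_space_eq)
  have "{0} \<in> null_sets F"
    using A1 by (auto simp: axiom_A1_def null_sets_def setsF sets_restrict_space_iff)
  then have "AE s in F. s \<notin> {0}" by (rule AE_not_in)
  \<comment> \<open>Since A1 excludes an atom at \<open>0\<close>, the kernel at \<open>0\<close>,
    whose edge is unconstrained, does not affect the integrals.\<close>
  then have AEpos: "AE s in F. s > 0"
    using AE_space by eventually_elim (auto simp: spaceF)
  obtain a where a: "a \<ge> 0"
    and lin: "\<And>s. s \<in> {0<..s_R} \<Longrightarrow>
      c_lo * s \<le> lower_edge K s - a \<and> lower_edge K s - a \<le> c_hi * s"
    and mono: "mono_on {0..} ((lower_edge K)(0 := a))"
    using A5 unfolding axiom_A5_minus_def by blast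
  \<comment> \<open>Monotonicity from the conventional value \<open>a\<close> at \<open>0\<close>
    gives this for all positive sources, also beyond \<open>s_R\<close>.\<close>
  have ge_a: "a \<le> lower_edge K s" if "s > 0" for s
    using mono_onD[OF mono, of 0 s] that by auto
  have edge_mono: "lower_edge K s \<le> lower_edge K s'" if "s > 0" "s \<le> s'" for s s'
    using mono_onD[OF mono, of s s'] that by auto
  obtain C1 C2 r0 where C: "C1 > 0" "C2 > 0" "r0 > 0"
    and FL: "\<And>r. 0 < r \<Longrightarrow> r \<le> r0 \<Longrightarrow> ennreal (C1 * r powr (\<alpha> + 1)) \<le> emeasure F {0<..r}"
    and FU: "\<And>r. 0 < r \<Longrightarrow> r \<le> r0 \<Longrightarrow> emeasure F {0<..r} \<le> ennreal (C2 * r powr (\<alpha> + 1))"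
    using axiom_A1_mass_bounds[OF A1 sb setsF] by blast
  obtain D1 D2 s1 \<eta> where D: "D1 > 0" "D2 > 0" "0 < s1" "s1 \<le> s_R" "\<eta> > 0"
    and KL: "\<And>s \<delta>. 0 < s \<Longrightarrow> s \<le> s1 \<Longrightarrow> 0 < \<delta> \<Longrightarrow> \<delta> \<le> \<eta> \<Longrightarrow>
       ennreal (D1 * \<delta> powr (\<beta> + 1)) \<le>
       emeasure (K s) {ennreal (lower_edge K s)..ennreal (lower_edge K s + \<delta>)}"
    and KU: "\<And>s \<delta>. 0 < s \<Longrightarrow> s \<le> s1 \<Longrightarrow> 0 < \<delta> \<Longrightarrow> \<delta> \<le> \<eta> \<Longrightarrow>
       emeasure (K s) {ennreal (lower_edge K s)..ennreal (lower_edge K s + \<delta>)} \<le>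
       ennreal (D2 * \<delta> powr (\<beta> + 1))"
    using axiom_A6_mass_bounds[OF A6 K sR] by blast
  \<comment> \<open>\<open>\<eta>\<close> bounds the window lengths for A6, and
    \<open>c_lo * r0\<close> keeps both source cutoffs, \<open>t / c_lo\<close> and
    \<open>t / (2 * c_hi)\<close>, within the range of the mass bounds for \<open>F\<close>. The
    half in \<open>c_lo * s1 / 2\<close> makes \<open>t / c_lo < s1\<close> strict, which places the
    larger cutoff strictly below \<open>s_R\<close>.\<close>
  define t0 where "t0 = Min {\<eta>, c_lo * s1 / 2, c_lo * r0}"
  have t0: "t0 > 0" "t0 \<le> \<eta>" "t0 \<le> c_lo * s1 / 2" "t0 \<le> c_lo * r0"
    using C D c by (auto simp: t0_def)
  \<comment> \<open>\<open>E1\<close> collects the factors for window length \<open>t / 2\<close>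
    and sources up to \<open>t / (2 * c_hi)\<close>, \<open>E2\<close> those for window length
    \<open>t\<close> and sources up to \<open>t / c_lo\<close>.\<close>
  define E1 where "E1 = D1 * (1/2) powr (\<beta> + 1) * (C1 * (1 / (2 * c_hi)) powr (\<alpha> + 1))"
  define E2 where "E2 = D2 * (C2 * (1 / c_lo) powr (\<alpha> + 1))"
  have "c_hi > 0" using c by simp
  then have E: "E1 > 0" "E2 > 0" using C(1,2) D(1,2) c(1) by (simp_all add: E1_def E2_def)
  show ?thesis
  proof (rule that[of a E1 E2 t0])
    have "emeasure (K s) {..<ennreal a} = 0" if "s > 0" for s
    proof -
      have "ennreal a \<le> ennreal (lower_edge K s)" using ge_a[OF that] by (rule ennreal_leI)
      then have "emeasure (K s) {..<ennreal a} \<le> emeasure (K s) {..<ennreal (lower_edge K s)}"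
        using that kernel_prob_space(2)[OF K, of s] by (intro emeasure_mono) auto
      then show ?thesis using emeasure_below_lower_edge[OF K, of s] that by simp
    qed
    with AEpos have "AE s in F. emeasure (K s) {..<ennreal a} = 0"
      by (rule eventually_mono)
    then have "(\<integral>\<^sup>+ s. emeasure (K s) {..<ennreal a} \<partial>F) = (\<integral>\<^sup>+ s. 0 \<partial>F)"
      by (rule nn_integral_cong_AE)
    then show "emeasure (observed_law F K) {..<ennreal a} = 0"
      by (subst emeasure_observed_law[OF K]) auto
  next
    fix t assume t: "0 < t" "t \<le> t0"
    define r where "r = t / (2 * c_hi)"
    have "c_lo * r \<le> c_hi * r" using t c by (intro mult_right_mono) (auto simp: r_def)
    also have "\<dots> = t / 2" using c by (simp add: r_def)
    finally have clr: "c_lo * r \<le> t / 2" .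
    have r: "r > 0" using t c by (simp add: r_def)
    have "c_lo * r \<le> c_lo * r0" "c_lo * r \<le> c_lo * s1"
      using clr t0 t mult_pos_pos[OF c(1) D(3)] by linarith+
    then have rr: "r \<le> r0" "r \<le> s1" using c by auto
    \<comment> \<open>For \<open>s \<le> r\<close> the edge uses up at most half of the excess
      \<open>t\<close>, so a window of length \<open>t / 2\<close> above the edge still fits below
      \<open>a + t\<close>.\<close>
    have low: "ennreal (D1 * (t/2) powr (\<beta> + 1)) \<le> emeasure (K s) {..ennreal (a + t)}"
      if s: "s \<in> {0<..r}" for s
    proof -
      have "c_hi * s \<le> c_hi * r" using s c by (intro mult_left_mono) auto
      also have "\<dots> = t / 2" using c by (simp add: r_def)
      finally have edge: "lower_edge K s \<le> a + t / 2"
        using lin[of s] s rr D by auto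
      have "ennreal (D1 * (t/2) powr (\<beta> + 1)) \<le>
          emeasure (K s) {ennreal (lower_edge K s)..ennreal (lower_edge K s + t/2)}"
        by (rule KL) (use s rr t t0 in simp_all)
      also have "\<dots> \<le> emeasure (K s) {..ennreal (a + t)}"
      proof (rule emeasure_mono)
        have "ennreal (lower_edge K s + t/2) \<le> ennreal (a + t)"
          using edge by (intro ennreal_leI) simp
        then show "{ennreal (lower_edge K s)..ennreal (lower_edge K s + t/2)} \<subseteq> {..ennreal (a + t)}"
          by (auto simp del: ennreal_plus)
      qed (use s kernel_prob_space(2)[OF K, of s] in auto)
      finally show ?thesis .
    qed
    have "ennreal (E1 * t powr (\<alpha> + \<beta> + 2)) =
        ennreal (D1 * (t/2) powr (\<beta> + 1)) * ennreal (C1 * r powr (\<alpha> + 1))"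
    proof -
      have "t powr (\<alpha> + \<beta> + 2) = t powr (\<beta> + 1) * t powr (\<alpha> + 1)"
        by (simp add: powr_add[symmetric] add_ac)
      moreover have "(t/2) powr (\<beta> + 1) = t powr (\<beta> + 1) * (1/2) powr (\<beta> + 1)"
        using powr_mult[of t "1/2" "\<beta> + 1"] t by simp
      moreover have "r powr (\<alpha> + 1) = t powr (\<alpha> + 1) * (1 / (2 * c_hi)) powr (\<alpha> + 1)"
        using powr_mult[of t "1 / (2 * c_hi)" "\<alpha> + 1"] t c by (simp add: r_def)
      ultimately show ?thesis
        using C D by (simp add: E1_def ennreal_mult[symmetric] mult_ac)
    qed
    also have "\<dots> \<le> ennreal (D1 * (t/2) powr (\<beta> + 1)) * emeasure F {0<..r}"
      using FL r rr by (intro mult_left_mono) auto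
    also have "\<dots> = (\<integral>\<^sup>+ s\<in>{0<..r}. ennreal (D1 * (t/2) powr (\<beta> + 1)) \<partial>F)"
      by (subst nn_integral_cmult_indicator) (auto simp: setsF sets_restrict_space_iff)
    also have "\<dots> \<le> (\<integral>\<^sup>+ s. emeasure (K s) {..ennreal (a + t)} \<partial>F)"
      using low by (intro nn_integral_mono) (auto simp: indicator_def)
    also have "\<dots> = emeasure (observed_law F K) {..ennreal (a + t)}"
      by (rule emeasure_observed_law[OF K, symmetric]) auto
    finally show "ennreal (E1 * t powr (\<alpha> + \<beta> + 2)) \<le>
      emeasure (observed_law F K) {..ennreal (a + t)}" .
  next
    fix t assume t: "0 < t" "t \<le> t0"
    define r where "r = t / c_lo"
    have clr: "c_lo * r = t" using c by (simp add: r_def)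
    have r: "r > 0" using t c by (simp add: r_def)
    have "c_lo * r \<le> c_lo * r0" "c_lo * r < c_lo * s1"
      using clr t0 t mult_pos_pos[OF c(1) D(3)] by linarith+
    then have rr: "r \<le> r0" "r < s1" using c by auto
    \<comment> \<open>For \<open>s \<le> r\<close> the edge is at least \<open>a\<close>, so the
      part of the window above the edge has length at most \<open>t\<close>. For
      \<open>s > r\<close> the edge has already passed \<open>a + t\<close> and nothing is
      observed.\<close>
    have up: "emeasure (K s) {..ennreal (a + t)} \<le>
        ennreal (D2 * t powr (\<beta> + 1)) * indicator {0<..r} s" if s: "s > 0" for s
    proof (cases "s \<le> r")
      case True
      have "emeasure (K s) {..ennreal (a + t)} =
          emeasure (K s) {ennreal (lower_edge K s)..ennreal (a + t)}"
        using s by (intro emeasure_atMost_eq_atLeastAtMost_lower_edge[OF K]) auto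
      also have "\<dots> \<le> emeasure (K s) {ennreal (lower_edge K s)..ennreal (lower_edge K s + t)}"
      proof (rule emeasure_mono)
        have "ennreal (a + t) \<le> ennreal (lower_edge K s + t)"
          using ge_a[OF s] by (intro ennreal_leI) simp
        then show "{ennreal (lower_edge K s)..ennreal (a + t)} \<subseteq>
            {ennreal (lower_edge K s)..ennreal (lower_edge K s + t)}"
          by (auto simp del: ennreal_plus)
      qed (use s kernel_prob_space(2)[OF K, of s] in auto)
      also have "\<dots> \<le> ennreal (D2 * t powr (\<beta> + 1))"
        by (rule KU) (use True s rr t t0 in simp_all)
      finally show ?thesis using True s by simp
    next
      case False
      \<comment> \<open>The linear lower bound on the edge holds only up to \<open>s_R\<close>. It
        is applied at the truncated source, which still exceeds \<open>r\<close>, and monotonicity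
        carries it on to \<open>s\<close>.\<close>
      define s' where "s' = min s s_R"
      have s': "0 < s'" "s' \<le> s" "s' \<le> s_R" "r < s'"
        using s sR False rr D by (auto simp: s'_def)
      have "t < c_lo * s'" using s'(4) clr c by (metis mult_strict_left_mono)
      also have "\<dots> \<le> lower_edge K s' - a" using lin[of s'] s' by auto
      also have "\<dots> \<le> lower_edge K s - a" using edge_mono[of s' s] s' by auto
      finally have "a + t < lower_edge K s" by simp
      then have "ennreal (a + t) < ennreal (lower_edge K s)"
        using a t by (intro ennreal_lessI) auto
      then have "emeasure (K s) {..ennreal (a + t)} \<le>
          emeasure (K s) {..<ennreal (lower_edge K s)}"
        using s kernel_prob_space(2)[OF K, of s]
        by (intro emeasure_mono) (auto simp del: ennreal_plus)
      then show ?thesis using emeasure_below_lower_edge[OF K, of s] s by simp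
    qed
    have "emeasure (observed_law F K) {..ennreal (a + t)} =
        (\<integral>\<^sup>+ s. emeasure (K s) {..ennreal (a + t)} \<partial>F)"
      by (rule emeasure_observed_law[OF K]) auto
    also have "\<dots> \<le> (\<integral>\<^sup>+ s\<in>{0<..r}. ennreal (D2 * t powr (\<beta> + 1)) \<partial>F)"
      using AEpos by (intro nn_integral_mono_AE) (rule eventually_mono, use up in auto)
    also have "\<dots> = ennreal (D2 * t powr (\<beta> + 1)) * emeasure F {0<..r}"
      by (subst nn_integral_cmult_indicator) (auto simp: setsF sets_restrict_space_iff)
    also have "\<dots> \<le> ennreal (D2 * t powr (\<beta> + 1)) * ennreal (C2 * r powr (\<alpha> + 1))"
      using FU r rr by (intro mult_left_mono) auto
    also have "\<dots> = ennreal (E2 * t powr (\<alpha> + \<beta> + 2))"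
    proof -
      have "t powr (\<alpha> + \<beta> + 2) = t powr (\<beta> + 1) * t powr (\<alpha> + 1)"
        by (simp add: powr_add[symmetric] add_ac)
      moreover have "r powr (\<alpha> + 1) = t powr (\<alpha> + 1) * (1 / c_lo) powr (\<alpha> + 1)"
        using powr_mult[of t "1 / c_lo" "\<alpha> + 1"] t c by (simp add: r_def)
      ultimately show ?thesis
        using C D by (simp add: E2_def ennreal_mult[symmetric] mult_ac)
    qed
    finally show "emeasure (observed_law F K) {..ennreal (a + t)} \<le>
      ennreal (E2 * t powr (\<alpha> + \<beta> + 2))" .
  qed (use a E t0 in simp_all)
qed

section \<open>Recovering the edge and the exponent\<close>

text \<open>If \<open>a < a'\<close>, a small \<open>t\<close> puts the window up to
  \<open>a + t\<close>, which has positive mass, inside the null ray below \<open>a'\<close>. Used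
  in both directions, this identifies the edge from the observed law alone.\<close>

lemma edge_le_if_null_below:
  fixes a a' t0 :: real and G :: "ennreal measure"
  assumes sets: "sets G = sets borel" and null: "emeasure G {..<ennreal a'} = 0"
    and t0: "t0 > 0" and a: "a \<ge> 0"
    and pos: "\<And>t. 0 < t \<Longrightarrow> t \<le> t0 \<Longrightarrow> emeasure G {..ennreal (a + t)} > 0"
  shows "a' \<le> a"
proof (rule ccontr)
  assume "\<not> a' \<le> a"
  define t where "t = min t0 ((a' - a) / 2)"
  have "t \<le> (a' - a) / 2" unfolding t_def by (rule min.cobounded2)
  with \<open>\<not> a' \<le> a\<close> have less: "a + t < a'" by simp
  have t: "0 < t" "t \<le> t0"
    using \<open>\<not> a' \<le> a\<close> t0 by (simp_all add: t_def)
  have "ennreal (a + t) < ennreal a'" using less t a by (intro ennreal_lessI) linarith+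
  then have "emeasure G {..ennreal (a + t)} \<le> emeasure G {..<ennreal a'}"
    by (intro emeasure_mono) (auto simp: sets simp del: ennreal_plus)
  with null pos[OF t] show False by simp
qed

text \<open>If \<open>q > p\<close>, dividing by \<open>t powr p\<close> leaves
  \<open>C \<le> D * t powr (q - p)\<close>, whose right side tends to \<open>0\<close> as
  \<open>t\<close> decreases to \<open>0\<close>, against \<open>C > 0\<close>.\<close>

lemma exponent_le_if_powr_le:
  fixes p q C D t0 :: real
  assumes C: "C > 0" and t0: "t0 > 0"
    and le: "\<And>t. 0 < t \<Longrightarrow> t \<le> t0 \<Longrightarrow> C * t powr p \<le> D * t powr q"
  shows "q \<le> p"
proof (rule ccontr)
  assume "\<not> q \<le> p"
  then have "((\<lambda>t::real. t powr (q - p)) \<longlongrightarrow> 0 powr (q - p)) (at_right 0)"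
    by (intro tendsto_powr' tendsto_ident_at tendsto_const disjI2 conjI)
      (auto simp: eventually_at_filter)
  then have "((\<lambda>t::real. D * t powr (q - p)) \<longlongrightarrow> 0) (at_right 0)"
    by (simp add: tendsto_mult_right_zero)
  then have "eventually (\<lambda>t. D * t powr (q - p) < C) (at_right 0)"
    using C by (rule order_tendstoD)
  then obtain b where b: "b > 0" "\<And>t. 0 < t \<Longrightarrow> t < b \<Longrightarrow> D * t powr (q - p) < C"
    unfolding eventually_at_right_field by blast
  define t where "t = min t0 (b / 2)"
  have t: "0 < t" "t \<le> t0" "t < b" using b(1) t0 by (auto simp: t_def)
  have "D * t powr q = D * t powr (q - p) * t powr p"
    by (simp add: powr_add[symmetric])
  also have "\<dots> < C * t powr p" using b(2) t by (intro mult_strict_right_mono) auto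
  finally show False using le[of t] t by simp
qed

theorem theorem4p2:
  fixes \<beta> c_lo c_hi sbar0 s_R \<alpha> \<alpha>' :: real
    and F F' :: "real measure"
    and K K' :: "real \<Rightarrow> ennreal measure"
  assumes "\<beta> \<ge> 0" and "0 < c_lo" and "c_lo \<le> c_hi"
    and "0 < sbar0" and "0 < s_R" and "s_R \<le> sbar0"
    and "(F, K) \<in> lean_class \<beta> c_lo c_hi sbar0 s_R"
    and "(F', K') \<in> lean_class \<beta> c_lo c_hi sbar0 s_R"
    and "axiom_A1 sbar0 F \<alpha>" and "axiom_A1 sbar0 F' \<alpha>'"
    and "observed_law F K = observed_law F' K'"
  shows "\<alpha> = \<alpha>'"
proof -
  define G where "G = observed_law F K"
  have K: "law_kernel_pair F K" using assms(7) by (auto simp: lean_class_def)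
  then have "F \<in> space (prob_algebra half_line)" "K \<in> half_line \<rightarrow>\<^sub>M prob_algebra borel"
    unfolding law_kernel_pair_def by simp_all
  then have sets: "sets G = sets borel"
    unfolding G_def observed_law_def by (rule sets_bind')
  obtain a C1 C2 t0 where a: "a \<ge> 0" "C1 > 0" "C2 > 0" "t0 > 0" "emeasure G {..<ennreal a} = 0"
    and L: "\<And>t. 0 < t \<Longrightarrow> t \<le> t0 \<Longrightarrow>
       ennreal (C1 * t powr (\<alpha> + \<beta> + 2)) \<le> emeasure G {..ennreal (a + t)}"
    and U: "\<And>t. 0 < t \<Longrightarrow> t \<le> t0 \<Longrightarrow>
       emeasure G {..ennreal (a + t)} \<le> ennreal (C2 * t powr (\<alpha> + \<beta> + 2))"
    unfolding G_def
    using observed_law_edge_asymptotics[OF assms(7,9,2-5)] by blast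
  obtain a' C1' C2' t0' where a': "a' \<ge> 0" "C1' > 0" "C2' > 0" "t0' > 0"
      "emeasure G {..<ennreal a'} = 0"
    and L': "\<And>t. 0 < t \<Longrightarrow> t \<le> t0' \<Longrightarrow>
       ennreal (C1' * t powr (\<alpha>' + \<beta> + 2)) \<le> emeasure G {..ennreal (a' + t)}"
    and U': "\<And>t. 0 < t \<Longrightarrow> t \<le> t0' \<Longrightarrow>
       emeasure G {..ennreal (a' + t)} \<le> ennreal (C2' * t powr (\<alpha>' + \<beta> + 2))"
    unfolding G_def assms(11)
    using observed_law_edge_asymptotics[OF assms(8,10,2-5)] by blast
  \<comment> \<open>The lower power bound of the first pair supplies positive mass just above
    \<open>a\<close>, while the second pair says that there is none below \<open>a'\<close>. The
    converse exchanges the pairs.\<close>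
  have "a' \<le> a"
  proof (rule edge_le_if_null_below[OF sets a'(5) a(4,1)])
    fix t assume t: "0 < t" "t \<le> t0"
    then have "0 < ennreal (C1 * t powr (\<alpha> + \<beta> + 2))" using a by simp
    also note L[OF t]
    finally show "0 < emeasure G {..ennreal (a + t)}" .
  qed
  moreover have "a \<le> a'"
  proof (rule edge_le_if_null_below[OF sets a(5) a'(4,1)])
    fix t assume t: "0 < t" "t \<le> t0'"
    then have "0 < ennreal (C1' * t powr (\<alpha>' + \<beta> + 2))" using a' by simp
    also note L'[OF t]
    finally show "0 < emeasure G {..ennreal (a' + t)}" .
  qed
  ultimately have eq: "a' = a" by simp
  \<comment> \<open>With the edges equal, both pairs describe the mass of the same windows. The
    lower bound of one pair is therefore at most the upper bound of the other. As
    \<open>\<beta>\<close> is shared, comparing exponents both ways gives equal shape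
    indices.\<close>
  have "\<alpha>' + \<beta> + 2 \<le> \<alpha> + \<beta> + 2"
  proof (rule exponent_le_if_powr_le[of C1 "min t0 t0'" _ C2'])
    fix t assume "0 < t" "t \<le> min t0 t0'"
    then have "ennreal (C1 * t powr (\<alpha> + \<beta> + 2)) \<le> ennreal (C2' * t powr (\<alpha>' + \<beta> + 2))"
      using L[of t] U'[of t] by (simp add: eq)
    then show "C1 * t powr (\<alpha> + \<beta> + 2) \<le> C2' * t powr (\<alpha>' + \<beta> + 2)"
      using a' by (simp add: ennreal_le_iff)
  qed (use a a' in auto)
  moreover have "\<alpha> + \<beta> + 2 \<le> \<alpha>' + \<beta> + 2"
  proof (rule exponent_le_if_powr_le[of C1' "min t0 t0'" _ C2])
    fix t assume "0 < t" "t \<le> min t0 t0'"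
    then have "ennreal (C1' * t powr (\<alpha>' + \<beta> + 2)) \<le> ennreal (C2 * t powr (\<alpha> + \<beta> + 2))"
      using L'[of t] U[of t] by (simp add: eq)
    then show "C1' * t powr (\<alpha>' + \<beta> + 2) \<le> C2 * t powr (\<alpha> + \<beta> + 2)"
      using a by (simp add: ennreal_le_iff)
  qed (use a a' in auto)
  ultimately show ?thesis by simp
qed

end
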